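(* Let $S=\{i_1<i_2<\dots<i_s=m\}$ be a nonempty admissible set. For integers $1\le j<k$, we have $|p_S(j)|\le|p_S(k)|$ provided $p_S(k)\ne 0$, except for the case $\{2\}\subsetneq S$ where $p_S(1)=-2p_S(3)=-(-2)^{|S|-1}$.
   Context: For a permutation $\pi=\pi_1\cdots\pi_n\in\mathfrak S_n$, an index $1<i<n$ is a peak if $\pi_{i-1}<\pi_i>\pi_{i+1}$; $P(\pi)$ is the set of peaks of $\pi$, and $\mathcal P_S(n)=\{\pi\in\mathfrak S_n: P(\pi)=S\}$. A finite set $S$ of positive integers is admissible if $\mathcal P_S(n)\neq\emptyset$ for some $n$; equivalently $1\notin S$ and $S$ contains no two consecutive integers. Known fact (Billey–Burdzy–Sagan): for a nonempty admissible $S$ with $m=\max(S)$ there is a unique polynomial $p_S(x)$, of degree $m-1$ and integer-valued on integers, such that $|\mathcal P_S(n)|=p_S(n)2^{n-|S|-1}$ for all $n\ge m$; $p_S$ is called the peak polynomial of $S$. *)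

theory Defs
  imports "HOL-Combinatorics.Permutations" "HOL-Computational_Algebra.Polynomial"
begin

definition peaks :: "nat \<Rightarrow> (nat \<Rightarrow> nat) \<Rightarrow> nat set" where
  "peaks n \<pi> = {i. 1 < i \<and> i < n \<and> \<pi> (i - 1) < \<pi> i \<and> \<pi> (i + 1) < \<pi> i}"

definition perms_with_peaks :: "nat set \<Rightarrow> nat \<Rightarrow> (nat \<Rightarrow> nat) set" where
  "perms_with_peaks S n = {\<pi>. \<pi> permutes {1..n} \<and> peaks n \<pi> = S}"

definition admissible :: "nat set \<Rightarrow> bool" where
  "admissible S \<longleftrightarrow> finite S \<and> (\<forall>i\<in>S. 0 < i) \<and> (\<exists>n. perms_with_peaks S n \<noteq> {})"

(* Meant for nonempty admissible S, where existence is the theorem of Billey, Burdzy and Sagan;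
   uniqueness holds since the values at infinitely many n are prescribed. The subtraction in the
   exponent does not truncate: an admissible S satisfies 2 * card S <= Max S <= n. *)
definition peak_poly :: "nat set \<Rightarrow> real poly" where
  "peak_poly S = (THE p. \<forall>n\<ge>Max S.
     real (card (perms_with_peaks S n)) = poly p (real n) * 2 ^ (n - card S - 1))"

end

theory Submission
  imports Defs "HOL-Library.Infinite_Set"
begin

text \<open>
  Write \<open>p[S]\<close> for the peak polynomial. Classifying arrangements by their first \<open>m - 1\<close> entries gives
  \<open>p[T \<union> {m}](x) = p[T](m - 1) * (x choose m - 1) - 2 * p[T](x) - p[T \<union> {m - 1}](x)\<close> when all elements of
  \<open>T\<close> are below \<open>m - 1\<close>, and this also yields existence. At an argument \<open>j < m - 1\<close> the binomial vanishes, so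
  the recursion determines the effect of the elements above \<open>j\<close>: if \<open>W\<close> is the nonempty part of \<open>S\<close> above
  \<open>j\<close> and \<open>T\<close> the rest, then \<open>p[S](j)\<close> is \<open>p[T](j)\<close> times \<open>(- 1) ^ |W| * 2 ^ (|W| - 1)\<close>, or zero if two
  successive elements of \<open>W\<close> have an odd difference. Since \<open>p[T]\<close> is nonnegative and increasing on the
  integers from \<open>max T\<close> on, only the loss of a factor 2 for each element of \<open>S\<close> between \<open>j\<close> and \<open>k\<close> has to be
  compensated. An element \<open>a \<ge> 4\<close> does so because \<open>a / 2 * p[T](a - 1) \<le> p[T \<union> {a}](a + 1)\<close>, and \<open>a = 3\<close> because
  \<open>p[{3}](4) = 2\<close>. For \<open>a = 2\<close> it fails only at the argument 3, which is the exception.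
\<close>

subsection \<open>Arrangements of finite sets\<close>

text \<open>Positions are counted from 1, as in \<^const>\<open>peaks\<close>, whereas \<open>!\<close> counts from 0.\<close>

definition list_peaks :: "nat list \<Rightarrow> nat set" where
  "list_peaks xs = {i. 1 < i \<and> i < length xs \<and> xs ! (i - 2) < xs ! (i - 1) \<and> xs ! i < xs ! (i - 1)}"

definition arrangements :: "nat set \<Rightarrow> nat set \<Rightarrow> nat list set" where
  "arrangements S X = {xs. distinct xs \<and> set xs = X \<and> list_peaks xs = S}"

lemma arrangementsI:
  "distinct xs \<Longrightarrow> set xs = X \<Longrightarrow> list_peaks xs = S \<Longrightarrow> xs \<in> arrangements S X"
  by (simp add: arrangements_def)

lemma arrangementsD:
  assumes "xs \<in> arrangements S X"
  shows "distinct xs" "set xs = X" "list_peaks xs = S" "length xs = card X"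
  using assms distinct_card by (force simp: arrangements_def)+

lemma finite_arrangements: "finite X \<Longrightarrow> finite (arrangements S X)"
  by (rule finite_subset[OF _ finite_lists_length_eq[of X "card X"]])
     (auto simp: arrangements_def distinct_card)

lemma list_peaks_map:
  assumes "strict_mono_on X h" "set xs \<subseteq> X"
  shows "list_peaks (map h xs) = list_peaks xs"
proof -
  have "h (xs ! a) < h (xs ! b) \<longleftrightarrow> xs ! a < xs ! b" if "a < length xs" "b < length xs" for a b
    using assms that by (meson nth_mem strict_mono_on_less subsetD)
  then show ?thesis
    by (auto simp: list_peaks_def)
qed

lemma card_arrangements_image:
  assumes "strict_mono_on X h"
  shows "card (arrangements S (h ` X)) = card (arrangements S X)"
proof -
  have inj: "inj_on h X"
    using assms strict_mono_on_imp_inj_on by blast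
  have "arrangements S (h ` X) = map h ` arrangements S X"
  proof (intro equalityI subsetI)
    fix xs assume xs: "xs \<in> arrangements S (h ` X)"
    let ?g = "inv_into X h"
    have eq: "map h (map ?g xs) = xs"
      unfolding map_map
      by (rule map_idI) (use arrangementsD(2)[OF xs] in \<open>simp add: f_inv_into_f\<close>)
    have st: "set (map ?g xs) = X"
      using arrangementsD(2)[OF xs] inj by (force simp: inv_into_f_f)
    have "distinct (map ?g xs)"
      using arrangementsD(1)[OF xs] eq by (metis distinct_map)
    moreover have "list_peaks (map ?g xs) = S"
      using list_peaks_map[OF assms, of "map ?g xs"] st eq arrangementsD(3)[OF xs] by simp
    ultimately have "map ?g xs \<in> arrangements S X"
      using st by (intro arrangementsI)
    then show "xs \<in> map h ` arrangements S X"
      using eq by (metis imageI)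
  next
    fix xs assume "xs \<in> map h ` arrangements S X"
    then obtain ys where ys: "ys \<in> arrangements S X" "xs = map h ys" by blast
    show "xs \<in> arrangements S (h ` X)"
      using arrangementsD[OF ys(1)] list_peaks_map[OF assms, of ys] inj
      by (intro arrangementsI) (auto simp: ys distinct_map)
  qed
  moreover have "inj_on (map h) (arrangements S X)"
    by (rule inj_onI) (metis arrangementsD(2) inj inj_on_map_eq_map sup.idem)
  ultimately show ?thesis
    by (simp add: card_image)
qed

text \<open>One-line notation: \<open>?f\<close> lists the values of a permutation, and
  \<open>?g\<close> reads them back, acting as the identity outside \<open>{1..n}\<close> as
  \<open>permutes\<close> demands.\<close>

lemma card_arrangements_interval:
  "card (arrangements S {1..n}) = card (perms_with_peaks S n)"
proof -
  let ?f = "\<lambda>\<pi>. map \<pi> [1..<Suc n]"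
  let ?g = "\<lambda>xs i. if i \<in> {1..n} then xs ! (i - 1) else i"
  have pk: "list_peaks (?f \<pi>) = peaks n \<pi>" for \<pi>
    by (auto simp: list_peaks_def peaks_def Suc_diff_le numeral_2_eq_2 Suc_diff_Suc simp del: upt_Suc)
  have "bij_betw ?f (perms_with_peaks S n) (arrangements S {1..n})"
  proof (rule bij_betw_byWitness[where f' = ?g])
    show "\<forall>\<pi>\<in>perms_with_peaks S n. ?g (?f \<pi>) = \<pi>"
      by (auto simp: perms_with_peaks_def permutes_def fun_eq_iff simp del: upt_Suc)
    show "\<forall>xs\<in>arrangements S {1..n}. ?f (?g xs) = xs"
      using arrangementsD(4) by (auto intro!: nth_equalityI simp del: upt_Suc)
    show "?f ` perms_with_peaks S n \<subseteq> arrangements S {1..n}"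
    proof
      fix xs assume "xs \<in> ?f ` perms_with_peaks S n"
      then obtain \<pi> where \<pi>: "\<pi> permutes {1..n}" "peaks n \<pi> = S" "xs = ?f \<pi>"
        by (auto simp: perms_with_peaks_def)
      then show "xs \<in> arrangements S {1..n}"
        using pk permutes_image[OF \<pi>(1)] permutes_inj_on[OF \<pi>(1)]
        by (intro arrangementsI)
           (auto simp: distinct_map atLeastLessThanSuc_atLeastAtMost simp del: upt_Suc)
    qed
    show "?g ` arrangements S {1..n} \<subseteq> perms_with_peaks S n"
    proof
      fix \<pi> assume "\<pi> \<in> ?g ` arrangements S {1..n}"
      then obtain xs where xs: "xs \<in> arrangements S {1..n}" and \<pi>: "\<pi> = ?g xs" by blast
      have eq: "?f \<pi> = xs"
        unfolding \<pi> using arrangementsD(4)[OF xs] by (auto intro!: nth_equalityI simp del: upt_Suc)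
      have im: "\<pi> ` {1..n} = {1..n}"
        using arrangementsD(2)[OF xs] eq
        by (metis atLeastLessThanSuc_atLeastAtMost set_map set_upt)
      moreover have "inj_on \<pi> {1..n}"
        using arrangementsD(1)[OF xs] eq
        by (metis atLeastLessThanSuc_atLeastAtMost distinct_map set_upt)
      ultimately have "bij_betw \<pi> {1..n} {1..n}"
        by (simp add: bij_betw_def)
      then have "\<pi> permutes {1..n}"
        by (rule bij_imp_permutes) (auto simp: \<pi>)
      then show "\<pi> \<in> perms_with_peaks S n"
        using pk[of \<pi>] eq arrangementsD(3)[OF xs] by (simp add: perms_with_peaks_def)
    qed
  qed
  then show ?thesis
    by (rule bij_betw_same_card[symmetric])
qed

text \<open>Peaks depend only on relative order, so \<open>X\<close> can be relabelled increasingly.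
  The enumeration used starts at 0, hence the shift by \<open>Suc\<close>.\<close>

lemma card_arrangements:
  assumes "finite X"
  shows "card (arrangements S X) = card (perms_with_peaks S (card X))"
proof -
  obtain h where h: "bij_betw h {..<card X} X" "strict_mono_on {..<card X} h"
    using ex_bij_betw_strict_mono_card[OF assms] by blast
  have "card (arrangements S (h ` {..<card X})) = card (arrangements S (Suc ` {..<card X}))"
    using card_arrangements_image[OF h(2)]
      card_arrangements_image[of "{..<card X}" Suc] by (simp add: strict_mono_on_def)
  moreover have "Suc ` {..<card X} = {1..card X}"
    by (simp add: image_Suc_lessThan)
  ultimately show ?thesis
    using h(1) card_arrangements_interval by (simp add: bij_betw_def)
qed

section \<open>Peaks of concatenations and prefixes\<close>

lemma list_peaks_append_left:
  "i < length ys \<Longrightarrow> i \<in> list_peaks (ys @ zs) \<longleftrightarrow> i \<in> list_peaks ys"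
  by (auto simp: list_peaks_def nth_append)

text \<open>The first entry of \<open>zs\<close> is left out: whether it is a peak of the whole list
  depends on the last entry of \<open>ys\<close>.\<close>

lemma list_peaks_append_right:
  "1 < i \<Longrightarrow> length ys + i \<in> list_peaks (ys @ zs) \<longleftrightarrow> i \<in> list_peaks zs"
  by (auto simp: list_peaks_def nth_append)

lemma list_peaks_subset: "list_peaks xs \<subseteq> {2..<length xs}"
  by (auto simp: list_peaks_def)

lemma list_peaks_take: "list_peaks (take k xs) = list_peaks xs \<inter> {..<k}"
  by (auto simp: list_peaks_def)

lemma not_consecutive_peaks: "i \<in> list_peaks xs \<Longrightarrow> Suc i \<notin> list_peaks xs"
  by (auto simp: list_peaks_def)

subsection \<open>Arrangements without peaks\<close>

text \<open>All prefixes have the same length, so a concatenation determines its prefix and the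
  images are disjoint.\<close>

lemma card_append_image:
  assumes "finite L" "\<And>ys. ys \<in> L \<Longrightarrow> length ys = k" "\<And>ys. ys \<in> L \<Longrightarrow> finite (V ys)"
  shows "card (\<Union>ys\<in>L. (@) ys ` V ys) = (\<Sum>ys\<in>L. card (V ys))"
proof -
  have "card (\<Union>ys\<in>L. (@) ys ` V ys) = (\<Sum>ys\<in>L. card ((@) ys ` V ys))"
    using assms by (intro card_UN_disjoint) auto
  also have "\<dots> = (\<Sum>ys\<in>L. card (V ys))"
    by (intro sum.cong refl card_image) (auto simp: inj_on_def)
  finally show ?thesis .
qed

text \<open>A leading maximum is no peak itself and gives its neighbour a larger left neighbour, so
  positions are merely shifted.\<close>

lemma list_peaks_Cons_greater:
  assumes "\<forall>x\<in>set xs. x < M"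
  shows "list_peaks (M # xs) = Suc ` list_peaks xs"
proof (intro equalityI subsetI)
  fix i assume "i \<in> list_peaks (M # xs)"
  then have i: "1 < i" "i < Suc (length xs)" "(M # xs) ! (i - 2) < xs ! (i - 2)"
      "xs ! (i - 1) < xs ! (i - 2)"
    by (auto simp: list_peaks_def nth_Cons' numeral_2_eq_2)
  then have "i \<noteq> 2"
    using assms nth_mem[of 0 xs] by (cases xs) auto
  then have "i - 1 \<in> list_peaks xs"
    using i by (auto simp: list_peaks_def nth_Cons' numeral_2_eq_2 numeral_3_eq_3)
  then show "i \<in> Suc ` list_peaks xs"
    using i by (intro image_eqI[of _ _ "i - 1"]) auto
next
  fix i assume "i \<in> Suc ` list_peaks xs"
  then obtain i' where i': "i = Suc i'" "i' \<in> list_peaks xs" by blast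
  then show "i \<in> list_peaks (M # xs)"
    using list_peaks_append_right[of i' "[M]" xs] by (auto simp: list_peaks_def)
qed

text \<open>The last position is never a peak, and the entry before it now has a larger right
  neighbour.\<close>

lemma list_peaks_snoc_greater:
  assumes "\<forall>x\<in>set xs. x < M"
  shows "list_peaks (xs @ [M]) = list_peaks xs"
proof -
  have "length xs \<notin> list_peaks (xs @ [M])"
    using assms by (auto simp: list_peaks_def nth_append not_less intro!: less_imp_le)
  then have "i \<in> list_peaks (xs @ [M]) \<longleftrightarrow> i \<in> list_peaks xs" for i
    using list_peaks_append_left[of i xs "[M]"] list_peaks_subset[of xs] list_peaks_subset[of "xs @ [M]"]
    by (cases "i < length xs"; cases "i = length xs") auto
  then show ?thesis by blast
qed

text \<open>A maximum in the interior would be a peak, so it stands at one of the two ends.\<close>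

lemma arrangements_no_peaks_insert:
  assumes "\<forall>x\<in>X. x < M"
  shows "arrangements {} (insert M X) =
    (#) M ` arrangements {} X \<union> (\<lambda>xs. xs @ [M]) ` arrangements {} X"
proof (intro equalityI subsetI)
  fix xs assume xs: "xs \<in> arrangements {} (insert M X)"
  then have "M \<in> set xs"
    using arrangementsD(2) by blast
  then obtain as bs where s: "xs = as @ M # bs"
    by (meson split_list)
  have st: "set as \<union> set bs = X" and d: "distinct (as @ bs)"
    using arrangementsD(1,2)[OF xs] assms unfolding s by auto
  have "as = [] \<or> bs = []"
  proof (rule ccontr)
    assume ne: "\<not> ?thesis"
    then have "as ! (length as - 1) < M" "bs ! 0 < M"
      using assms st by (metis UnCI diff_less length_greater_0_conv nth_mem zero_less_one)+
    then have "Suc (length as) \<in> list_peaks xs"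
      using ne by (auto simp: list_peaks_def s nth_append numeral_2_eq_2)
    then show False
      using arrangementsD(3)[OF xs] by simp
  qed
  then have "as @ bs \<in> arrangements {} X \<and> (xs = M # (as @ bs) \<or> xs = (as @ bs) @ [M])"
    using arrangementsD(3)[OF xs] st d s list_peaks_snoc_greater[of as M]
      list_peaks_Cons_greater[of bs M] assms
    by (auto intro!: arrangementsI)
  then show "xs \<in> (#) M ` arrangements {} X \<union> (\<lambda>xs. xs @ [M]) ` arrangements {} X"
    by blast
next
  fix xs assume "xs \<in> (#) M ` arrangements {} X \<union> (\<lambda>xs. xs @ [M]) ` arrangements {} X"
  then obtain ys where ys: "ys \<in> arrangements {} X" "xs = M # ys \<or> xs = ys @ [M]"
    by blast
  then show "xs \<in> arrangements {} (insert M X)"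
    using arrangementsD[OF ys(1)] assms list_peaks_snoc_greater[of ys M]
      list_peaks_Cons_greater[of ys M]
    by (auto intro!: arrangementsI)
qed

text \<open>In front, the maximum is the head and any peakless rest may follow; at the end it leaves
  the head alone, as \<open>X\<close> is nonempty. The bound \<open>y\<close> will be the value at
  the last peak, just before the peakless tail.\<close>

lemma card_filter_no_peaks_insert:
  assumes "finite X" "X \<noteq> {}" "\<forall>x\<in>X. x < M"
  shows "card {zs \<in> arrangements {} (insert M X). hd zs < y} =
    (if M < y then card (arrangements {} X) else 0) + card {zs \<in> arrangements {} X. hd zs < y}"
proof -
  have ne: "zs \<noteq> []" if "zs \<in> arrangements {} X" for zs
    using arrangementsD(2)[OF that] assms(2) by auto
  have eq: "{zs \<in> arrangements {} (insert M X). hd zs < y} =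
      (if M < y then (#) M ` arrangements {} X else {}) \<union>
      (\<lambda>xs. xs @ [M]) ` {zs \<in> arrangements {} X. hd zs < y}"
    unfolding arrangements_no_peaks_insert[OF assms(3)] using ne by auto
  have disj: "(#) M ` arrangements {} X \<inter> (\<lambda>xs. xs @ [M]) ` {zs \<in> arrangements {} X. hd zs < y} = {}"
  proof -
    have False if "zs \<in> arrangements {} X" "M # ys = zs @ [M]" for ys zs
      using that ne[OF that(1)] arrangementsD(2)[OF that(1)] assms(3) by (cases zs) auto
    then show ?thesis by blast
  qed
  have "card ((#) M ` arrangements {} X) = card (arrangements {} X)"
    "card ((\<lambda>xs. xs @ [M]) ` {zs \<in> arrangements {} X. hd zs < y}) = card {zs \<in> arrangements {} X. hd zs < y}"
    by (intro card_image; auto simp: inj_on_def)+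
  then show ?thesis
    unfolding eq using disj finite_arrangements[OF assms(1)]
    by (auto simp: card_Un_disjoint)
qed

lemma arrangements_singleton: "arrangements {} {x} = {[x]}"
proof (intro equalityI subsetI)
  fix xs assume "xs \<in> arrangements {} {x}"
  from arrangementsD[OF this] show "xs \<in> {[x]}"
    by (cases xs) (auto simp: Suc_length_conv)
qed (auto simp: arrangements_def list_peaks_def)

lemma card_arrangements_no_peaks:
  assumes "finite X" "X \<noteq> {}"
  shows "card (arrangements {} X) = 2 ^ (card X - 1)"
  using assms
proof (induction X rule: finite_linorder_max_induct)
  case (insert M X)
  show ?case
  proof (cases "X = {}")
    case True
    then show ?thesis by (simp add: arrangements_singleton)
  next
    case False
    \<comment> \<open>A bound above all entries makes the filter void, so the filtered recursion
      becomes a plain doubling.\<close>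
    let ?y = "Suc M"
    have eq: "{zs \<in> arrangements {} Y. hd zs < ?y} = arrangements {} Y"
      if "Y \<subseteq> insert M X" "Y \<noteq> {}" for Y
    proof -
      have "hd zs < ?y" if "zs \<in> arrangements {} Y" for zs
      proof -
        have "hd zs \<in> Y"
          using arrangementsD(2)[OF that] \<open>Y \<noteq> {}\<close> by (metis hd_in_set set_empty)
        then show ?thesis
          using insert.hyps(2) \<open>Y \<subseteq> insert M X\<close> by (auto simp: less_Suc_eq)
      qed
      then show ?thesis by blast
    qed
    have "card X > 0"
      using False insert.hyps by (simp add: card_gt_0_iff)
    moreover have "M \<notin> X"
      using insert.hyps(2) by blast
    ultimately show ?thesis
      using card_filter_no_peaks_insert[OF insert.hyps(1) False insert.hyps(2), of ?y]
        eq[OF subset_insertI False] eq[OF subset_refl insert_not_empty] False insert.IH insert.hyps(1)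
      by (cases "card X") auto
  qed
qed simp

text \<open>Removing the maximum \<open>M\<close> gives the same recursion on both sides. Its extra
  term, present only if \<open>M < y\<close>, counts all peakless arrangements, and \<open>z\<close>
  doubles that number exactly.\<close>

lemma card_filter_no_peaks_insert_min:
  assumes "finite X" "X \<noteq> {}" "\<forall>x\<in>X. z < x"
  shows "2 * card {zs \<in> arrangements {} X. hd zs < y} \<le>
    card {zs \<in> arrangements {} (insert z X). hd zs < y}"
  using assms
proof (induction X rule: finite_linorder_max_induct)
  case (insert M X)
  have less: "\<forall>x\<in>insert z X. x < M"
    using insert.hyps insert.prems by auto
  show ?case
  proof (cases "X = {}")
    case True
    have "{zs \<in> arrangements {} {x}. hd zs < y} = (if x < y then {[x]} else {})" for x
      by (auto simp: arrangements_singleton)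
    then show ?thesis
      using card_filter_no_peaks_insert[of "{z}" M y] less True
      by (auto simp: arrangements_singleton insert_commute)
  next
    case False
    have "2 * card (arrangements {} X) = card (arrangements {} (insert z X))"
    proof -
      have "card X > 0" "z \<notin> X"
        using insert.hyps False insert.prems by (auto simp: card_gt_0_iff)
      then show ?thesis
        using card_arrangements_no_peaks[of X] card_arrangements_no_peaks[of "insert z X"] False insert.hyps(1)
        by (cases "card X") auto
    qed
    then show ?thesis
      using card_filter_no_peaks_insert[of "insert z X" M y] less False insert
        card_filter_no_peaks_insert[of X M y]
      by (auto simp: insert_commute)
  qed
qed simp

subsection \<open>Counting by the last peak\<close>

abbreviation peak_count :: "nat set \<Rightarrow> nat \<Rightarrow> nat" where
  "peak_count S n \<equiv> card (perms_with_peaks S n)"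

text \<open>Cut an arrangement whose peaks below \<open>k\<close> are \<open>T\<close> and which has no peak above \<open>k + 1\<close> after its
  first \<open>k\<close> entries: the two parts are an arbitrary arrangement with peak set \<open>T\<close> and an arbitrary one
  without peaks, while at most one of \<open>k\<close> and \<open>k + 1\<close> is a peak of the whole.\<close>

lemma peak_count_rec:
  assumes "T \<subseteq> {..<k}" "0 < k" "k < n"
  shows "peak_count T n + peak_count (insert k T) n + peak_count (insert (Suc k) T) n =
    (n choose k) * peak_count T k * 2 ^ (n - k - 1)"
proof -
  define X where "X = {1..n}"
  have X: "finite X" "card X = n"
    by (simp_all add: X_def)
  define A where "A = {xs. distinct xs \<and> set xs = X \<and> list_peaks xs \<inter> {..<k} = T \<and> list_peaks xs \<inter> {Suc k<..} = {}}"
  define L where "L = (\<Union>Y\<in>{Y. Y \<subseteq> X \<and> card Y = k}. arrangements T Y)"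
  have fin: "finite Y" if "Y \<subseteq> X" for Y
    using X finite_subset that by blast
  have "A = arrangements T X \<union> arrangements (insert k T) X \<union> arrangements (insert (Suc k) T) X"
  proof (intro equalityI subsetI)
    fix xs assume xs: "xs \<in> A"
    then have 1: "list_peaks xs \<inter> {..<k} = T" "list_peaks xs \<inter> {Suc k<..} = {}"
      by (auto simp: A_def)
    have "i < k \<or> i = k \<or> i = Suc k \<or> i > Suc k" for i
      by linarith
    then have "list_peaks xs = (list_peaks xs \<inter> {..<k}) \<union> (list_peaks xs \<inter> {k, Suc k}) \<union> (list_peaks xs \<inter> {Suc k<..})"
      by blast
    then have "list_peaks xs = T \<union> (list_peaks xs \<inter> {k, Suc k})"
      using 1 by simp
    moreover have "list_peaks xs \<inter> {k, Suc k} \<in> {{}, {k}, {Suc k}}"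
      using not_consecutive_peaks[of k xs] by auto
    ultimately have "list_peaks xs \<in> {T, insert k T, insert (Suc k) T}"
      by auto
    then show "xs \<in> arrangements T X \<union> arrangements (insert k T) X \<union> arrangements (insert (Suc k) T) X"
      using xs by (auto simp: A_def arrangements_def)
  next
    fix xs assume xs: "xs \<in> arrangements T X \<union> arrangements (insert k T) X \<union> arrangements (insert (Suc k) T) X"
    then show "xs \<in> A"
      using assms(1) by (auto simp: A_def arrangements_def)
  qed
  moreover have "arrangements S X \<inter> arrangements S' X = {}" if "S \<noteq> S'" for S S'
    using that by (auto simp: arrangements_def)
  moreover have "T \<noteq> insert k T" "T \<noteq> insert (Suc k) T" "insert k T \<noteq> insert (Suc k) T"
    using assms(1) by auto
  ultimately have "card A = peak_count T n + peak_count (insert k T) n + peak_count (insert (Suc k) T) n"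
    using finite_arrangements[OF X(1)] card_arrangements[OF X(1)] X(2)
    by (simp add: card_Un_disjoint Int_Un_distrib2)
  moreover have "A = (\<Union>ys\<in>L. (@) ys ` arrangements {} (X - set ys))"
  proof (intro equalityI subsetI)
    fix xs assume xs: "xs \<in> A"
    define ys zs where "ys = take k xs" and "zs = drop k xs"
    have e: "xs = ys @ zs" "length ys = k" and d: "distinct ys" "distinct zs" "set ys \<inter> set zs = {}" and st: "set ys \<union> set zs = X"
    proof -
      have "length xs = n"
        using xs X(2) distinct_card[of xs] by (auto simp: A_def)
      then show "xs = ys @ zs" "length ys = k"
        using assms by (auto simp: ys_def zs_def)
      then show "distinct ys" "distinct zs" "set ys \<inter> set zs = {}" "set ys \<union> set zs = X"
        using xs by (auto simp: A_def)
    qed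
    have "ys \<in> arrangements T (set ys)"
      using xs d by (auto simp: A_def ys_def list_peaks_take intro!: arrangementsI)
    then have "ys \<in> L"
      using st d(1) e(2) distinct_card[of ys] by (auto simp: L_def)
    \<comment> \<open>A peak of \<open>zs\<close> has position at least 2, so in \<open>xs\<close>
      it would lie beyond \<open>Suc k\<close>.\<close>
    moreover have "list_peaks zs = {}"
    proof (rule ccontr)
      assume "list_peaks zs \<noteq> {}"
      then obtain i where i: "i \<in> list_peaks zs" by blast
      then have "1 < i" by (simp add: list_peaks_def)
      then have "k + i \<in> list_peaks xs \<inter> {Suc k<..}"
        using list_peaks_append_right[of i ys zs] i e by auto
      then show False
        using xs by (auto simp: A_def)
    qed
    then have "zs \<in> arrangements {} (X - set ys)"
      using d st by (intro arrangementsI) auto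
    ultimately show "xs \<in> (\<Union>ys\<in>L. (@) ys ` arrangements {} (X - set ys))"
      using e(1) by blast
  next
    fix xs assume "xs \<in> (\<Union>ys\<in>L. (@) ys ` arrangements {} (X - set ys))"
    then obtain Y ys zs where Y: "Y \<subseteq> X" "card Y = k" and ys: "ys \<in> arrangements T Y"
      and "zs \<in> arrangements {} (X - set ys)" and e: "xs = ys @ zs"
      unfolding L_def by blast
    then have zs: "zs \<in> arrangements {} (X - Y)"
      using arrangementsD(2)[OF ys] by simp
    note ys = arrangementsD[OF ys] and zs = arrangementsD[OF zs]
    have len: "length ys = k"
      using ys Y by simp
    have "i \<in> list_peaks xs \<longleftrightarrow> i \<in> T" if "i < k" for i
      using list_peaks_append_left[of i ys zs] that len ys(3) e by simp
    then have "list_peaks xs \<inter> {..<k} = T"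
      using assms(1) by blast
    moreover have "i \<notin> list_peaks xs" if "Suc k < i" for i
      using list_peaks_append_right[of "i - k" ys zs] that len zs(3) e by simp
    then have "list_peaks xs \<inter> {Suc k<..} = {}"
      by auto
    ultimately show "xs \<in> A"
      using ys zs Y by (auto simp: A_def e)
  qed
  moreover have Lfin: "finite L"
    unfolding L_def using X(1) fin by (auto intro!: finite_arrangements)
  moreover have Llen: "length ys = k \<and> set ys \<subseteq> X \<and> card (set ys) = k" if "ys \<in> L" for ys
    using that arrangementsD by (auto simp: L_def)
  ultimately have "peak_count T n + peak_count (insert k T) n + peak_count (insert (Suc k) T) n =
      (\<Sum>ys\<in>L. card (arrangements {} (X - set ys)))"
    using card_append_image[of L k "\<lambda>ys. arrangements {} (X - set ys)"] finite_arrangements X(1)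
    by simp
  also have "\<dots> = (\<Sum>ys\<in>L. 2 ^ (n - k - 1))"
  proof (rule sum.cong[OF refl])
    fix ys assume "ys \<in> L"
    then have c: "card (X - set ys) = n - k"
      using Llen X by (simp add: card_Diff_subset)
    then have "X - set ys \<noteq> {}"
      using assms(3) by (intro notI) simp
    then show "card (arrangements {} (X - set ys)) = 2 ^ (n - k - 1)"
      using card_arrangements_no_peaks[of "X - set ys"] c X(1) by simp
  qed
  also have "\<dots> = card L * 2 ^ (n - k - 1)"
    by simp
  \<comment> \<open>A prefix amounts to a \<open>k\<close>-subset of \<open>X\<close> and an
    arrangement of it with peak set \<open>T\<close>.\<close>
  also have "card L = (\<Sum>Y\<in>{Y. Y \<subseteq> X \<and> card Y = k}. card (arrangements T Y))"
    unfolding L_def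
  proof (rule card_UN_disjoint)
    show "\<forall>Y\<in>{Y. Y \<subseteq> X \<and> card Y = k}. finite (arrangements T Y)"
      using finite_arrangements fin by blast
    show "\<forall>Y\<in>{Y. Y \<subseteq> X \<and> card Y = k}. \<forall>Z\<in>{Y. Y \<subseteq> X \<and> card Y = k}. Y \<noteq> Z \<longrightarrow> arrangements T Y \<inter> arrangements T Z = {}"
      using arrangementsD(2) by blast
  qed (use X(1) in simp)
  also have "\<dots> = (\<Sum>Y\<in>{Y. Y \<subseteq> X \<and> card Y = k}. peak_count T k)"
    using card_arrangements fin by (intro sum.cong) auto
  also have "\<dots> = (n choose k) * peak_count T k"
    using n_subsets[OF X(1), of k] X(2) by simp
  finally show ?thesis .
qed

text \<open>A peak at \<open>m\<close> splits into an ascent at the end of the prefix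
  \<open>ys\<close> and the bound \<open>hd zs < last ys\<close> on the tail. For
  \<open>m \<le> 1\<close> the clause \<open>1 < m\<close> makes both sides empty.\<close>

lemma arrangements_last_peak:
  assumes "T \<subseteq> {..<m}" "m < card X" "finite X"
  shows "arrangements (insert m T) X =
    (\<Union>ys\<in>{ys. distinct ys \<and> set ys \<subseteq> X \<and> length ys = m \<and> list_peaks ys = T \<and> 1 < m \<and> ys ! (m - 2) < ys ! (m - 1)}.
      (@) ys ` {zs \<in> arrangements {} (X - set ys). hd zs < last ys})" (is "_ = (\<Union>ys\<in>?L. ?A ys)")
proof (intro equalityI subsetI)
  fix xs assume xs: "xs \<in> arrangements (insert m T) X"
  note xsD = arrangementsD[OF xs]
  define ys zs where "ys = take m xs" and "zs = drop m xs"
  have e: "xs = ys @ zs" "length ys = m" "zs \<noteq> []"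
    using xsD(4) assms(2) by (auto simp: ys_def zs_def)
  have d: "distinct ys" "distinct zs" "set ys \<inter> set zs = {}" "set ys \<union> set zs = X"
    using e(1) xsD(1,2) by auto
  have "m \<in> list_peaks xs"
    using xsD(3) by simp
  then have m: "1 < m" "ys ! (m - 2) < ys ! (m - 1)" "zs ! 0 < ys ! (m - 1)"
    using e by (auto simp: list_peaks_def nth_append split: if_splits)
  have "last ys = ys ! (m - 1)"
    using m(1) e(2) by (metis last_conv_nth length_0_conv not_one_less_zero)
  then have hd: "hd zs < last ys"
    using m(3) e(3) by (simp add: hd_conv_nth)
  have "list_peaks ys = T"
    using xsD(3) assms(1) by (auto simp: ys_def list_peaks_take)
  then have "ys \<in> ?L"
    using d m e by auto
  moreover have "list_peaks zs = {}"
  proof (rule ccontr)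
    assume "list_peaks zs \<noteq> {}"
    then obtain i where i: "i \<in> list_peaks zs" by blast
    then have "1 < i" by (simp add: list_peaks_def)
    then have "m + i \<in> list_peaks xs"
      using list_peaks_append_right[of i ys zs] i e by auto
    then show False
      using xsD(3) assms(1) \<open>1 < i\<close> by auto
  qed
  then have "zs \<in> arrangements {} (X - set ys)"
    using d by (intro arrangementsI) auto
  ultimately show "xs \<in> (\<Union>ys\<in>?L. ?A ys)"
    using e(1) hd by blast
next
  fix xs assume "xs \<in> (\<Union>ys\<in>?L. ?A ys)"
  then obtain ys zs where ys: "ys \<in> ?L" and zs: "zs \<in> arrangements {} (X - set ys)" "hd zs < last ys"
    and e: "xs = ys @ zs" by blast
  note zsD = arrangementsD[OF zs(1)]
  have ysD: "distinct ys" "set ys \<subseteq> X" "length ys = m" "list_peaks ys = T" "1 < m" "ys ! (m - 2) < ys ! (m - 1)"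
    using ys by auto
  have "card (set ys) = m"
    using ysD distinct_card by auto
  then have "X \<noteq> set ys"
    using assms(2) by auto
  then have ne: "zs \<noteq> []"
    using zsD(2) ysD(2) by auto
  have "last ys = ys ! (m - 1)"
    using ysD by (metis last_conv_nth length_0_conv not_one_less_zero)
  then have m: "m \<in> list_peaks xs"
    using ysD zs(2) ne by (auto simp: e list_peaks_def nth_append hd_conv_nth)
  have "i \<in> list_peaks xs \<longleftrightarrow> i \<in> insert m T" for i
  proof -
    consider "i < m" | "i = m" | "i = Suc m" | "i > Suc m"
      by linarith
    then show ?thesis
    proof cases
      case 1
      then show ?thesis
        using list_peaks_append_left[of i ys zs] ysD e by simp
    next
      case 2
      then show ?thesis using m by simp
    next
      case 3
      then show ?thesis using not_consecutive_peaks[OF m] assms(1) by auto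
    next
      case 4
      then show ?thesis
        using list_peaks_append_right[of "i - m" ys zs] ysD(3) zsD(3) e assms(1) by auto
    qed
  qed
  then show "xs \<in> arrangements (insert m T) X"
    using ysD zsD by (auto intro!: arrangementsI simp: e)
qed

text \<open>Cutting after the last peak leaves a peakless tail whose first entry is bounded; a new least
  element added to the tail at least doubles the number of choices.\<close>

lemma peak_count_double:
  assumes "T \<subseteq> {..<m}" "m < n"
  shows "2 * peak_count (insert m T) n \<le> peak_count (insert m T) (Suc n)"
proof -
  define X where "X = {1..n}"
  define L where "L = (\<lambda>X. {ys. distinct ys \<and> set ys \<subseteq> X \<and> length ys = m \<and> list_peaks ys = T \<and> 1 < m \<and> ys ! (m - 2) < ys ! (m - 1)})"
  define V where "V = (\<lambda>Y y. {zs \<in> arrangements {} Y. hd zs < (y::nat)})"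
  have Vfin: "finite (V Y y)" if "finite Y" for Y y
    using that finite_arrangements by (simp add: V_def)
  have Lfin: "finite (L Y)" if "finite Y" for Y
    using finite_lists_length_eq[OF that, of m] by (rule rev_finite_subset) (auto simp: L_def)
  have eq: "peak_count (insert m T) (card Y) = (\<Sum>ys\<in>L Y. card (V (Y - set ys) (last ys)))"
    if "finite Y" "m < card Y" for Y
  proof -
    have "peak_count (insert m T) (card Y) = card (\<Union>ys\<in>L Y. (@) ys ` V (Y - set ys) (last ys))"
      using card_arrangements[OF that(1), of "insert m T"] arrangements_last_peak[OF assms(1) that(2,1)]
      by (simp add: L_def V_def)
    also have "\<dots> = (\<Sum>ys\<in>L Y. card (V (Y - set ys) (last ys)))"
      using Lfin Vfin that by (intro card_append_image[of _ m]) (auto simp: L_def)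
    finally show ?thesis .
  qed
  \<comment> \<open>The value 0 serves as the new least element.\<close>
  have X: "finite X" "card X = n" "0 \<notin> X"
    by (auto simp: X_def)
  have "2 * peak_count (insert m T) n = (\<Sum>ys\<in>L X. 2 * card (V (X - set ys) (last ys)))"
    using eq[OF X(1)] X(2) assms(2) by (simp add: sum_distrib_left)
  also have "\<dots> \<le> (\<Sum>ys\<in>L X. card (V (insert 0 X - set ys) (last ys)))"
  proof (rule sum_mono)
    fix ys assume "ys \<in> L X"
    then have "set ys \<subseteq> X" "card (set ys) = m"
      using distinct_card by (auto simp: L_def)
    then have "X - set ys \<noteq> {}" "insert 0 X - set ys = insert 0 (X - set ys)"
      using X assms(2) by auto
    moreover have "\<forall>x\<in>X - set ys. 0 < x"
      by (auto simp: X_def)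
    ultimately show "2 * card (V (X - set ys) (last ys)) \<le> card (V (insert 0 X - set ys) (last ys))"
      unfolding V_def using card_filter_no_peaks_insert_min[of "X - set ys" 0 "last ys"] X(1) by simp
  qed
  \<comment> \<open>So far 0 was in the tail; allowing it in the prefix only adds terms.\<close>
  also have "\<dots> \<le> (\<Sum>ys\<in>L (insert 0 X). card (V (insert 0 X - set ys) (last ys)))"
    using Lfin X(1) by (intro sum_mono2) (auto simp: L_def)
  also have "\<dots> = peak_count (insert m T) (Suc n)"
    using eq[of "insert 0 X"] X assms(2) by simp
  finally show ?thesis .
qed

text \<open>Append the maximum and then an arbitrary entry.\<close>

lemma peak_count_insert_ge:
  assumes "T \<subseteq> {..<k}" "0 < k"
  shows "Suc k * peak_count T k \<le> peak_count (insert (Suc k) T) (Suc (Suc k))"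
proof -
  define X where "X = {..Suc k}"
  have X: "finite X" "card X = Suc (Suc k)"
    by (auto simp: X_def)
  \<comment> \<open>Values start at 0: \<open>v\<close> is the final entry, with
    \<open>Suc k\<close> choices, and \<open>ys\<close> arranges the other values up to
    \<open>k\<close>.\<close>
  let ?I = "SIGMA v:{..k}. arrangements T ({..k} - {v})"
  let ?f = "\<lambda>(v, ys). ys @ [Suc k, v]"
  have "?f ` ?I \<subseteq> arrangements (insert (Suc k) T) X"
  proof
    fix xs assume "xs \<in> ?f ` ?I"
    then obtain v ys where v: "v \<le> k" and ys: "ys \<in> arrangements T ({..k} - {v})" and xs: "xs = ys @ [Suc k, v]"
      by auto
    note ysD = arrangementsD[OF ys]
    have len: "length ys = k"
      using ysD(4) v by simp
    then have "ys ! (k - 1) \<in> set ys"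
      using assms(2) by simp
    then have lt: "ys ! (k - 1) < Suc k"
      using ysD(2) by auto
    have "i \<in> list_peaks xs \<longleftrightarrow> i \<in> insert (Suc k) T" for i
    proof -
      consider "i < k" | "i = k" | "i = Suc k" | "i > Suc k"
        by linarith
      then show ?thesis
      proof cases
        case 1
        then show ?thesis
          using list_peaks_append_left[of i ys] len ysD(3) xs by simp
      next
        case 2
        then show ?thesis
          using assms len lt by (auto simp: xs list_peaks_def nth_append)
      next
        case 3
        then show ?thesis
          using assms len lt v by (auto simp: xs list_peaks_def nth_append)
      next
        case 4
        then show ?thesis
          using assms len by (auto simp: xs list_peaks_def)
      qed
    qed
    moreover have "distinct xs"
      using ysD(1,2) v by (simp add: xs)
    moreover have "set xs = X"
      unfolding xs X_def set_append ysD(2) using v by auto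
    ultimately show "xs \<in> arrangements (insert (Suc k) T) X"
      by (auto intro!: arrangementsI)
  qed
  then have "card (?f ` ?I) \<le> card (arrangements (insert (Suc k) T) X)"
    by (intro card_mono finite_arrangements X)
  moreover have "card (?f ` ?I) = card ?I"
    by (intro card_image) (auto simp: inj_on_def)
  moreover have "card ?I = (\<Sum>v\<le>k. card (arrangements T ({..k} - {v})))"
    using finite_arrangements by (intro card_SigmaI) auto
  moreover have "\<dots> = (\<Sum>v\<le>k. peak_count T k)"
    using card_arrangements by (intro sum.cong) auto
  ultimately show ?thesis
    using card_arrangements[OF X(1), of "insert (Suc k) T"] X(2) by simp
qed

subsection \<open>Existence and recursion of the peak polynomial\<close>

lemma peak_count_empty: "0 < n \<Longrightarrow> peak_count {} n = 2 ^ (n - 1)"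
  using card_arrangements_no_peaks[of "{1..n}"] card_arrangements_interval[of "{}" n] by simp

lemma peak_count_eq_0:
  assumes "i \<in> S" "i < 2 \<or> n \<le> i \<or> Suc i \<in> S"
  shows "peak_count S n = 0"
proof -
  have "peaks n \<pi> \<noteq> S" for \<pi>
    using assms by (auto simp: peaks_def)
  then show ?thesis
    by (simp add: perms_with_peaks_def)
qed

text \<open>Both sides are multiplied by a power of 2, so that no exponent involves a truncated subtraction.\<close>

definition counting_poly :: "nat set \<Rightarrow> real poly \<Rightarrow> bool" where
  "counting_poly S p \<longleftrightarrow> (\<forall>n>0. S \<subseteq> {..n} \<longrightarrow>
    real (peak_count S n) * 2 ^ Suc (card S) = poly p (real n) * 2 ^ n)"

definition binomial_poly :: "nat \<Rightarrow> real poly" where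
  "binomial_poly k = smult (1 / fact k) (\<Prod>i<k. [:- real i, 1:])"

lemma poly_binomial_poly: "poly (binomial_poly k) (real n) = real (n choose k)"
  by (simp add: binomial_poly_def poly_prod binomial_gbinomial gbinomial_prod_rev lessThan_atLeast0)

text \<open>This is \<open>peak_count_rec\<close> multiplied by \<open>2 * 2 ^ Suc (card T)\<close>.
  The term of \<open>T\<close> keeps a factor 2 because \<open>T\<close> has one element fewer than
  the other two sets.\<close>

lemma counting_poly_rec:
  assumes "T \<subseteq> {..<k}" "0 < k" "counting_poly T p" "counting_poly (insert k T) q"
  shows "counting_poly (insert (Suc k) T) (smult (poly p (real k)) (binomial_poly k) - smult 2 p - q)"
  unfolding counting_poly_def
proof (intro allI impI)
  fix n assume "0 < n" "insert (Suc k) T \<subseteq> {..n}"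
  then have n: "k < n" "0 < n" "T \<subseteq> {..n}" "insert k T \<subseteq> {..n}" "T \<subseteq> {..k}"
    using assms(1) by auto
  have fin: "finite T"
    using assms(1) finite_subset by blast
  have card: "card (insert k T) = Suc (card T)" "card (insert (Suc k) T) = Suc (card T)"
    using assms(1) fin by (auto simp: card_insert_if)
  have p: "real (peak_count T n) * 2 ^ Suc (card T) = poly p (real n) * 2 ^ n"
    "real (peak_count T k) * 2 ^ Suc (card T) = poly p (real k) * 2 ^ k"
    using assms(2,3) n by (auto simp: counting_poly_def)
  have q: "real (peak_count (insert k T) n) * (2 * 2 ^ Suc (card T)) = poly q (real n) * 2 ^ n"
    using assms(4) n card by (simp add: counting_poly_def)
  have "real (peak_count T n) + real (peak_count (insert k T) n) + real (peak_count (insert (Suc k) T) n) =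
      real (n choose k) * real (peak_count T k) * 2 ^ (n - k - 1)"
    using arg_cong[OF peak_count_rec[OF assms(1,2) n(1)], of real] by simp
  then have "(real (peak_count T n) + real (peak_count (insert k T) n) + real (peak_count (insert (Suc k) T) n)) * (2 * 2 ^ Suc (card T)) =
      real (n choose k) * real (peak_count T k) * 2 ^ (n - k - 1) * (2 * 2 ^ Suc (card T))"
    by simp
  also have "\<dots> = real (n choose k) * (real (peak_count T k) * 2 ^ Suc (card T)) * (2 * 2 ^ (n - k - 1))"
    by (simp only: mult_ac)
  also have "\<dots> = real (n choose k) * poly p (real k) * (2 ^ k * (2 * 2 ^ (n - k - 1)))"
    unfolding p(2) by (simp only: mult_ac)
  \<comment> \<open>Here \<open>k < n\<close> prevents truncation.\<close>
  also have "2 ^ k * (2 * 2 ^ (n - k - 1)) = (2::real) ^ n"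
    using n(1) by (simp flip: power_add power_Suc)
  finally have "real (peak_count (insert (Suc k) T) n) * (2 * 2 ^ Suc (card T)) =
      real (n choose k) * poly p (real k) * 2 ^ n - 2 * (real (peak_count T n) * 2 ^ Suc (card T))
      - real (peak_count (insert k T) n) * (2 * 2 ^ Suc (card T))"
    by (simp add: algebra_simps)
  also have "\<dots> = (real (n choose k) * poly p (real k) - 2 * poly p (real n) - poly q (real n)) * 2 ^ n"
    unfolding p(1) q by (simp add: algebra_simps)
  finally show "real (peak_count (insert (Suc k) T) n) * 2 ^ Suc (card (insert (Suc k) T)) =
     poly (smult (poly p (real k)) (binomial_poly k) - smult 2 p - q) (real n) * 2 ^ n"
    by (simp add: card poly_binomial_poly mult_ac)
qed

lemma counting_poly_0:
  assumes "i \<in> S" "i < 2 \<or> Suc i \<in> S"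
  shows "counting_poly S 0"
  using peak_count_eq_0[OF assms(1)] assms(2) by (auto simp: counting_poly_def)

lemma counting_poly_empty: "counting_poly {} 1"
  by (simp add: counting_poly_def peak_count_empty flip: power_Suc2 power_Suc)

text \<open>The recursion removes the maximum or lowers it by one, so the sum of the elements
  decreases. Sets that violate the peak conditions have the zero polynomial, which ends the
  recursion.\<close>

lemma counting_poly_exists:
  assumes "finite S"
  shows "\<exists>p. counting_poly S p"
  using assms
proof (induction "\<Sum>S" arbitrary: S rule: less_induct)
  case less
  show ?case
  proof (cases "S = {} \<or> (\<exists>i\<in>S. i < 2 \<or> Suc i \<in> S)")
    case True
    then show ?thesis
      using counting_poly_0 counting_poly_empty by blast
  next
    case False
    define k where "k = Max S - 1"
    define T where "T = S - {Max S}"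
    have "Max S \<in> S"
      using False less.prems by (intro Max_in) auto
    then have k: "Max S = Suc k" "0 < k" "S = insert (Suc k) T" "Suc k \<notin> T" "finite T"
      using False less.prems by (force simp: k_def T_def)+
    have "k \<notin> T"
      using False k(3) by auto
    moreover have "x \<le> Suc k" if "x \<in> T" for x
      using that less.prems k(1,3) by (metis Max_ge insertI2)
    ultimately have T: "T \<subseteq> {..<k}"
      using k(4) by (metis le_Suc_eq lessThan_iff nat_less_le subsetI)
    have "\<Sum>T < \<Sum>S" "\<Sum>(insert k T) < \<Sum>S"
      using k \<open>k \<notin> T\<close> by auto
    then obtain p q where "counting_poly T p" "counting_poly (insert k T) q"
      using less.hyps[of T] less.hyps[of "insert k T"] k(5) by blast
    then show ?thesis
      using counting_poly_rec[OF T k(2)] k(3) by blast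
  qed
qed

lemma poly_eqI_of_nat:
  fixes p q :: "real poly"
  assumes "\<And>n. N \<le> n \<Longrightarrow> poly p (real n) = poly q (real n)"
  shows "p = q"
proof (rule ccontr)
  assume "p \<noteq> q"
  then have "finite {x. poly (p - q) x = 0}"
    by (intro poly_roots_finite) simp
  moreover have "real ` {N..} \<subseteq> {x. poly (p - q) x = 0}"
    using assms by auto
  ultimately have "finite (real ` {N..})"
    using finite_subset by blast
  then show False
    using infinite_Ici[of N] by (simp add: finite_image_iff)
qed

text \<open>Turns the definite description into \<open>counting_poly\<close>; uniqueness comes from
  agreement at infinitely many integers.\<close>

lemma peak_poly_eqI:
  assumes "finite S" "counting_poly S p"
  shows "peak_poly S = p"
proof -
  have *: "real (peak_count S n) = poly p (real n) * 2 ^ (n - card S - 1)" if n: "Max S \<le> n" for n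
  proof -
    have p: "real (peak_count S n) * 2 ^ Suc (card S) = poly p (real n) * 2 ^ n" if "0 < n" "S \<subseteq> {..n}" for n
      using assms(2) that by (simp add: counting_poly_def)
    have S_le: "S \<subseteq> {..n}"
      using n assms(1) by (meson Max_ge atMost_iff le_trans subsetI)
    \<comment> \<open>The exponent \<open>n - card S - 1\<close> can truncate only in the first two
      cases, where the polynomial is 1 and 0 respectively.\<close>
    consider "S = {}" "n = 0" | "\<exists>i\<in>S. i < 2" | "\<forall>i\<in>S. 2 \<le> i" "0 < n"
    proof (cases "n = 0")
      case True
      then have "S = {} \<or> 0 \<in> S"
        using S_le by auto
      then show ?thesis
        using that(1,2) True zero_less_numeral by blast
    qed (use that(2,3) in \<open>meson not_le gr0I\<close>)
    then show ?thesis
    proof cases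
      case 1
      have "p = 1"
      proof (rule poly_eqI_of_nat)
        fix n' :: nat assume "1 \<le> n'"
        then obtain l where l: "n' = Suc l"
          by (cases n') auto
        have "2 ^ l * 2 = poly p (real n') * (2 ^ l * 2)"
          using p[of n'] peak_count_empty[of n'] 1(1) by (simp add: l del: of_nat_Suc)
        then show "poly p (real n') = poly 1 (real n')"
          by simp
      qed
      moreover have "perms_with_peaks {} 0 = {id}"
        by (auto simp: perms_with_peaks_def peaks_def)
      ultimately show ?thesis
        using 1 by simp
    next
      case 2
      then have 0: "peak_count S n = 0" for n
        using peak_count_eq_0 by blast
      have "p = 0"
      proof (rule poly_eqI_of_nat)
        fix n' assume "Suc n \<le> n'"
        then have "0 < n'" "S \<subseteq> {..n'}"
          using S_le by auto
        then show "poly p (real n') = poly 0 (real n')"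
          using p[of n'] 0 by simp
      qed
      then show ?thesis
        using 0 by simp
    next
      case 3
      have "S \<subseteq> {2..n}"
        using 3 S_le by auto
      then have "card S \<le> n - 1"
        using card_mono[of "{2..n}" S] by simp
      then have "(2::real) ^ n = 2 ^ (n - card S - 1) * 2 ^ Suc (card S)"
        using 3(2) by (simp flip: power_add power_Suc)
      then show ?thesis
        using p[OF 3(2) S_le] by simp
    qed
  qed
  show ?thesis
    unfolding peak_poly_def
  proof (rule the_equality)
    fix q assume q: "\<forall>n\<ge>Max S. real (peak_count S n) = poly q (real n) * 2 ^ (n - card S - 1)"
    show "q = p"
    proof (rule poly_eqI_of_nat)
      fix n assume n: "Max S \<le> n"
      have "poly q (real n) * 2 ^ (n - card S - 1) = poly p (real n) * 2 ^ (n - card S - 1)"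
        using q *[OF n] n by metis
      then show "poly q (real n) = poly p (real n)"
        by simp
    qed
  qed (use * in blast)
qed

lemma counting_poly_peak_poly: "finite S \<Longrightarrow> counting_poly S (peak_poly S)"
  using counting_poly_exists peak_poly_eqI by blast

lemma peak_poly_empty: "peak_poly {} = 1"
  by (intro peak_poly_eqI counting_poly_empty) simp

lemma peak_poly_eq_0: "finite S \<Longrightarrow> i \<in> S \<Longrightarrow> i < 2 \<or> Suc i \<in> S \<Longrightarrow> peak_poly S = 0"
  by (intro peak_poly_eqI counting_poly_0)

lemma peak_poly_rec:
  assumes "T \<subseteq> {..<k}" "0 < k"
  shows "peak_poly (insert (Suc k) T) =
    smult (poly (peak_poly T) (real k)) (binomial_poly k) - smult 2 (peak_poly T) - peak_poly (insert k T)"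
proof -
  have "finite T"
    using assms finite_subset by blast
  then show ?thesis
    using assms by (intro peak_poly_eqI counting_poly_rec counting_poly_peak_poly) auto
qed

section \<open>Values at integers not below the largest peak\<close>

lemma poly_peak_poly:
  assumes "0 < n" "S \<subseteq> {..n}"
  shows "poly (peak_poly S) (real n) = real (peak_count S n) * 2 ^ Suc (card S) / 2 ^ n"
proof -
  have "finite S"
    using assms finite_subset by blast
  then show ?thesis
    using counting_poly_peak_poly[of S] assms by (simp add: counting_poly_def field_simps)
qed

lemma poly_peak_poly_nonneg: "0 < n \<Longrightarrow> S \<subseteq> {..n} \<Longrightarrow> 0 \<le> poly (peak_poly S) (real n)"
  by (simp add: poly_peak_poly)

lemma poly_peak_poly_Max:
  "0 < n \<Longrightarrow> S \<subseteq> {..n} \<Longrightarrow> n \<in> S \<Longrightarrow> poly (peak_poly S) (real n) = 0"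
  by (simp add: poly_peak_poly peak_count_eq_0[of n])

text \<open>One more position doubles the normalising power of 2, so the claim is that counts at
  least double, which is \<open>peak_count_double\<close> beyond the largest peak. At the largest
  peak itself the value is 0.\<close>

lemma poly_peak_poly_mono:
  assumes "0 < j" "S \<subseteq> {..j}" "j \<le> k"
  shows "poly (peak_poly S) (real j) \<le> poly (peak_poly S) (real k)"
  using assms(3)
proof (induction k rule: dec_induct)
  case (step n)
  have n: "0 < n" "S \<subseteq> {..n}" "S \<subseteq> {..Suc n}"
    using assms step.hyps by auto
  have "poly (peak_poly S) (real n) \<le> poly (peak_poly S) (real (Suc n))"
  proof (cases "S = {}")
    case True
    then show ?thesis by (simp add: peak_poly_empty)
  next
    case False
    define m T where "m = Max S" and "T = S - {m}"
    have fin: "finite S"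
      using n finite_subset by blast
    then have m: "m \<in> S" "\<forall>x\<in>S. x \<le> m"
      using False by (auto simp: m_def)
    then have T: "S = insert m T" "T \<subseteq> {..<m}"
      using m by (force simp: T_def)+
    show ?thesis
    proof (cases "m = n")
      case True
      then show ?thesis
        using poly_peak_poly_Max[OF n(1,2)] poly_peak_poly_nonneg[OF _ n(3)] m(1) by simp
    next
      case False
      then have "m < n"
        using m(1) n(2) by auto
      then have "2 * peak_count S n \<le> peak_count S (Suc n)"
        using peak_count_double[OF T(2)] T(1) by simp
      then have "2 * real (peak_count S n) \<le> real (peak_count S (Suc n))"
        by linarith
      then have "2 * real (peak_count S n) * 2 ^ card S \<le> real (peak_count S (Suc n)) * 2 ^ card S"
        by (intro mult_right_mono) auto
      moreover have "poly (peak_poly S) (real n) * 2 ^ n = 2 * real (peak_count S n) * 2 ^ card S"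
        "poly (peak_poly S) (real (Suc n)) * 2 ^ n = real (peak_count S (Suc n)) * 2 ^ card S"
        using counting_poly_peak_poly[OF fin, unfolded counting_poly_def, rule_format, OF n(1,2)]
          counting_poly_peak_poly[OF fin, unfolded counting_poly_def, rule_format, OF zero_less_Suc n(3)]
        by (simp_all del: of_nat_Suc)
      ultimately have "poly (peak_poly S) (real n) * 2 ^ n \<le> poly (peak_poly S) (real (Suc n)) * 2 ^ n"
        by simp
      then show ?thesis
        by simp
    qed
  qed
  then show ?case
    using step.IH by linarith
qed simp

text \<open>Normalises \<open>peak_count_insert_ge\<close>: two more positions contribute a factor
  1/4 and one more peak a factor 2.\<close>

lemma poly_peak_poly_insert_ge:
  assumes "T \<subseteq> {..<k}" "0 < k"
  shows "real (Suc k) / 2 * poly (peak_poly T) (real k) \<le>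
    poly (peak_poly (insert (Suc k) T)) (real (Suc (Suc k)))"
proof -
  have fin: "finite T"
    using assms(1) finite_subset by blast
  have k: "T \<subseteq> {..k}" "insert (Suc k) T \<subseteq> {..Suc (Suc k)}"
    using assms(1) by auto
  have card: "card (insert (Suc k) T) = Suc (card T)"
    using assms(1) fin by (auto simp: card_insert_if)
  have "real (Suc k * peak_count T k) \<le> real (peak_count (insert (Suc k) T) (Suc (Suc k)))"
    using peak_count_insert_ge[OF assms] of_nat_le_iff by blast
  then have "real (Suc k) * real (peak_count T k) * (2 ^ card T / 2 ^ k) \<le>
      real (peak_count (insert (Suc k) T) (Suc (Suc k))) * (2 ^ card T / 2 ^ k)"
    unfolding of_nat_mult by (intro mult_right_mono) auto
  then show ?thesis
    unfolding poly_peak_poly[OF assms(2) k(1)] poly_peak_poly[OF zero_less_Suc k(2)] card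
    by (simp add: field_simps)
qed

subsection \<open>Comparison of values\<close>

lemma poly_peak_poly_2: "poly (peak_poly {2}) (real n) = real n - 2"
proof -
  have "peak_poly {2} = binomial_poly 1 - smult 2 1 - peak_poly {1}"
    using peak_poly_rec[of "{}" 1] by (simp add: peak_poly_empty numeral_2_eq_2)
  then show ?thesis
    using peak_poly_eq_0[of "{1}" 1] by (simp add: poly_binomial_poly)
qed

lemma poly_peak_poly_3: "poly (peak_poly {3}) 4 = 2"
proof -
  have "peak_poly {3} = binomial_poly 2 - smult 2 1 - peak_poly {2}"
    using peak_poly_rec[of "{}" 2] by (simp add: peak_poly_empty)
  then show ?thesis
    using poly_peak_poly_2[of 4] poly_binomial_poly[of 2 4] by (simp add: choose_two)
qed

text \<open>Computed directly, since the value of \<open>peak_poly {2}\<close> at 3 is only 1 and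
  doubling it would give just 2.\<close>

lemma poly_peak_poly_4_2: "poly (peak_poly {4, 2}) 5 = 4"
proof -
  have "peak_poly {4, 2} = smult (poly (peak_poly {2}) 3) (binomial_poly 3) - smult 2 (peak_poly {2}) - peak_poly {3, 2}"
    using peak_poly_rec[of "{2}" 3] by simp
  moreover have "peak_poly {3, 2} = 0"
    by (rule peak_poly_eq_0[of _ 2]) auto
  ultimately show ?thesis
    using poly_peak_poly_2[of 5] poly_peak_poly_2[of 3] poly_binomial_poly[of 3 5]
    by (simp add: eval_nat_numeral)
qed

text \<open>For \<open>k \<ge> 3\<close> the factor \<open>Suc k / 2\<close> is at least 2. For
  \<open>k = 2\<close>, either \<open>T\<close> is empty and the inserted peak is 3, or
  \<open>T\<close> has an element below 2 and its polynomial is 0.\<close>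

lemma poly_peak_poly_insert_double:
  assumes "T \<subseteq> {..<k}" "2 \<le> k" "Suc k < n"
  shows "2 * poly (peak_poly T) (real k) \<le> poly (peak_poly (insert (Suc k) T)) (real n)"
proof -
  have fin: "finite T"
    using assms(1) finite_subset by blast
  have sub: "T \<subseteq> {..k}" "insert (Suc k) T \<subseteq> {..Suc (Suc k)}"
    using assms(1) by auto
  have "2 * poly (peak_poly T) (real k) \<le> poly (peak_poly (insert (Suc k) T)) (real (Suc (Suc k)))"
  proof (cases "k = 2")
    case True
    show ?thesis
    proof (cases "T = {}")
      case True
      then show ?thesis
        using poly_peak_poly_3 \<open>k = 2\<close> by (simp add: peak_poly_empty)
    next
      case False
      then obtain i where "i \<in> T" by blast
      then have "peak_poly T = 0"
        using assms(1) \<open>k = 2\<close> fin by (intro peak_poly_eq_0[of _ i]) auto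
      then show ?thesis
        using poly_peak_poly_nonneg[OF zero_less_Suc sub(2)] by simp
    qed
  next
    case False
    then have "3 \<le> k"
      using assms(2) by linarith
    then have "2 \<le> real (Suc k) / 2"
      by simp
    then have "2 * poly (peak_poly T) (real k) \<le> real (Suc k) / 2 * poly (peak_poly T) (real k)"
      using poly_peak_poly_nonneg[OF _ sub(1)] assms(2) by (intro mult_right_mono) auto
    also have "\<dots> \<le> poly (peak_poly (insert (Suc k) T)) (real (Suc (Suc k)))"
      using assms by (intro poly_peak_poly_insert_ge) auto
    finally show ?thesis .
  qed
  also have "\<dots> \<le> poly (peak_poly (insert (Suc k) T)) (real n)"
    using assms(3) sub by (intro poly_peak_poly_mono) auto
  finally show ?thesis .
qed

text \<open>The largest element \<open>a\<close> of \<open>W\<close> is split off and the bound for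
  the rest used at \<open>a - 1\<close>. This exceeds all remaining peaks because none are
  consecutive, so inserting \<open>a\<close> doubles the value.\<close>

lemma poly_peak_poly_Un_ge:
  assumes "finite W" "0 < j" "j \<le> k" "T \<subseteq> {..j}" "W \<subseteq> {j<..<k}" "\<forall>i\<in>W. 3 \<le> i"
    and "\<forall>i\<in>T \<union> W. Suc i \<notin> T \<union> W"
  shows "2 ^ card W * poly (peak_poly T) (real j) \<le> poly (peak_poly (T \<union> W)) (real k)"
  using assms
proof (induction W arbitrary: k rule: finite_linorder_max_induct)
  case empty
  then show ?case
    using poly_peak_poly_mono by simp
next
  case (insert a W)
  define l where "l = a - 1"
  have a: "a = Suc l" "2 \<le> l" "j \<le> l"
    using insert.prems by (auto simp: l_def)
  have "l \<notin> T \<union> W"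
    using insert.prems(6) a(1) by auto
  moreover have W: "\<forall>x\<in>W. x \<le> l"
    using insert.hyps(2) a(1) by auto
  moreover have "\<forall>x\<in>T. x \<le> l"
    using insert.prems(3) a(3) by auto
  ultimately have "\<forall>x\<in>T \<union> W. x < l"
    by (metis UnE nat_less_le)
  then have sub: "T \<union> W \<subseteq> {..<l}"
    by blast
  have "W \<subseteq> {j<..<l}" "\<forall>i\<in>W. 3 \<le> i" "\<forall>i\<in>T \<union> W. Suc i \<notin> T \<union> W"
    using insert.prems(4-6) sub by (simp_all add: subset_iff)
  then have "2 ^ card W * poly (peak_poly T) (real j) \<le> poly (peak_poly (T \<union> W)) (real l)"
    using insert.prems(1,3) a(3) by (intro insert.IH)
  moreover have "2 * poly (peak_poly (T \<union> W)) (real l) \<le> poly (peak_poly (insert a (T \<union> W))) (real k)"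
    unfolding a(1) using insert.prems(4) a by (intro poly_peak_poly_insert_double sub) auto
  moreover have "card (insert a W) = Suc (card W)"
    using insert.hyps by (auto simp: card_insert_if)
  ultimately show ?case
    by simp
qed

text \<open>Serves the case where the peak 2 lies between the arguments: it contributes
  \<open>k - 2 \<ge> 2\<close>. Splitting off \<open>a = 4\<close> would lead to the argument 3,
  where this fails, so that case uses the computed value.\<close>

lemma poly_peak_poly_insert_2_ge:
  assumes "finite W" "4 \<le> k" "\<forall>i\<in>W. 4 \<le> i \<and> i < k" "\<forall>i\<in>W. Suc i \<notin> W"
  shows "2 ^ Suc (card W) \<le> poly (peak_poly (insert 2 W)) (real k)"
  using assms
proof (induction W arbitrary: k rule: finite_linorder_max_induct)
  case empty
  then show ?case
    using poly_peak_poly_2[of k] by simp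
next
  case (insert a W)
  define l where "l = a - 1"
  have a: "a = Suc l" "3 \<le> l"
    using insert.prems by (auto simp: l_def)
  have card: "card (insert a W) = Suc (card W)"
    using insert.hyps by (auto simp: card_insert_if)
  show ?case
  proof (cases "l = 3")
    case True
    then have "W = {}" "a = 4"
      using insert.prems(2) insert.hyps(2) a by force+
    moreover have "poly (peak_poly {4, 2}) (real 5) \<le> poly (peak_poly {4, 2}) (real k)"
      using insert.prems(2) \<open>a = 4\<close> by (intro poly_peak_poly_mono) auto
    ultimately show ?thesis
      using poly_peak_poly_4_2 by (simp add: insert_commute)
  next
    case False
    have "l \<notin> W"
      using insert.prems(3) a(1) by auto
    moreover have "\<forall>x\<in>W. x \<le> l"
      using insert.hyps(2) a(1) by auto
    ultimately have W: "\<forall>x\<in>W. x < l"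
      by (metis nat_less_le)
    have "2 ^ Suc (card W) \<le> poly (peak_poly (insert 2 W)) (real l)"
      using insert.prems a W False by (intro insert.IH) auto
    moreover have "2 * poly (peak_poly (insert 2 W)) (real l) \<le> poly (peak_poly (insert a (insert 2 W))) (real k)"
      unfolding a(1) using W a insert.prems(2) by (intro poly_peak_poly_insert_double) auto
    ultimately show ?thesis
      using card by (simp add: insert_commute)
  qed
qed

text \<open>For \<open>a = Suc j\<close> the binomial is 1 and the polynomial of
  \<open>insert j T\<close> vanishes at \<open>j\<close>, leaving \<open>1 - 2\<close>. For larger
  \<open>a\<close> the binomial is 0, and the recursion gives \<open>- 2 - (- 1)\<close>.\<close>

lemma poly_peak_poly_insert_above:
  assumes "T \<subseteq> {..j}" "0 < j" "j < a"
  shows "poly (peak_poly (insert a T)) (real j) = - poly (peak_poly T) (real j)"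
proof -
  have fin: "finite T"
    using assms(1) finite_subset by blast
  have "Suc j \<le> a"
    using assms(3) by simp
  then show ?thesis
  proof (induction a rule: dec_induct)
    case base
    show ?case
    proof (cases "j \<in> T")
      case True
      then show ?thesis
        using peak_poly_eq_0[of "insert (Suc j) T" j] fin poly_peak_poly_Max[OF assms(2,1)] by simp
    next
      case False
      then have "T \<subseteq> {..<j}"
        using assms(1) by (metis atMost_iff lessThan_iff nat_less_le subset_iff)
      then show ?thesis
        using peak_poly_rec[of T j] assms(2) poly_peak_poly_Max[of j "insert j T"] assms(1)
        by (simp add: poly_binomial_poly)
    qed
  next
    case (step n)
    then have "T \<subseteq> {..<n}" "0 < n"
      using assms(1) by auto
    then show ?case
      using step peak_poly_rec[of T n] by (simp add: poly_binomial_poly)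
  qed
qed

text \<open>The binomial vanishes, so each step sends a value \<open>v\<close> to
  \<open>- 2 * poly (peak_poly S) (real j) - v\<close>. Starting from 0 at the forbidden
  \<open>a = Suc b\<close>, the values alternate.\<close>

lemma poly_peak_poly_insert_above_peak:
  assumes "S \<subseteq> {..b}" "b \<in> S" "j < b" "b < a"
  shows "poly (peak_poly (insert a S)) (real j) =
    (if even (a - b) then - 2 * poly (peak_poly S) (real j) else 0)"
proof -
  have fin: "finite S"
    using assms(1) finite_subset by blast
  have "Suc b \<le> a"
    using assms(4) by simp
  then show ?thesis
  proof (induction a rule: dec_induct)
    case base
    show ?case
      using peak_poly_eq_0[of "insert (Suc b) S" b] fin assms(2) by simp
  next
    case (step n)
    then have "S \<subseteq> {..<n}" "0 < n"
      using assms(1) by auto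
    then show ?case
      using step peak_poly_rec[of S n] assms(3) by (simp add: poly_binomial_poly Suc_diff_le)
  qed
qed

text \<open>The factor \<open>c\<close> vanishes exactly when some difference of successive elements of \<open>W\<close> is odd. It must
  not depend on \<open>j\<close>, because two arguments between the same elements of a peak set are compared.\<close>

lemma poly_peak_poly_below:
  assumes "finite W" "W \<noteq> {}"
  shows "\<exists>c. c \<in> {0, (- 1) ^ card W * 2 ^ (card W - 1)} \<and>
    (\<forall>T j. 0 < j \<longrightarrow> T \<subseteq> {..j} \<longrightarrow> W \<subseteq> {j<..} \<longrightarrow>
      poly (peak_poly (T \<union> W)) (real j) = c * poly (peak_poly T) (real j))"
  using assms
proof (induction W rule: finite_linorder_max_induct)
  case (insert a W)
  show ?case
  proof (cases "W = {}")
    case True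
    then show ?thesis
      using poly_peak_poly_insert_above by (intro exI[of _ "-1"]) auto
  next
    case False
    then obtain c where c: "c \<in> {0, (- 1) ^ card W * 2 ^ (card W - 1)}"
      "\<And>T j. 0 < j \<Longrightarrow> T \<subseteq> {..j} \<Longrightarrow> W \<subseteq> {j<..} \<Longrightarrow>
        poly (peak_poly (T \<union> W)) (real j) = c * poly (peak_poly T) (real j)"
      using insert.IH by blast
    define b where "b = Max W"
    have b: "b \<in> W" "W \<subseteq> {..b}"
      using False insert.hyps(1) by (auto simp: b_def)
    then have "b < a"
      using insert.hyps(2) by blast
    have "card (insert a W) = Suc (card W)"
      using insert.hyps by (auto simp: card_insert_if)
    moreover have "card W \<noteq> 0"
      using False insert.hyps(1) by simp
    ultimately have c': "(if even (a - b) then - 2 * c else 0) \<in> {0, (- 1) ^ card (insert a W) * 2 ^ (card (insert a W) - 1)}"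
      using c(1) by (cases "card W") auto
    have "poly (peak_poly (T \<union> insert a W)) (real j) = (if even (a - b) then - 2 * c else 0) * poly (peak_poly T) (real j)"
      if "0 < j" "T \<subseteq> {..j}" "insert a W \<subseteq> {j<..}" for T j
    proof -
      have "j < b" "W \<subseteq> {j<..}"
        using that(3) b(1) by auto
      moreover from this have "T \<union> W \<subseteq> {..b}"
        using that(2) b(2) by force
      ultimately show ?thesis
        using poly_peak_poly_insert_above_peak[of "T \<union> W" b j a] c(2)[OF that(1,2)] b \<open>b < a\<close>
        by simp
    qed
    then show ?thesis
      using c' by blast
  qed
qed simp

lemma admissible_peaks:
  assumes "admissible S" "i \<in> S"
  shows "2 \<le> i" "Suc i \<notin> S"
  using assms peak_count_eq_0[of i S] 
  by (auto simp: admissible_def perms_with_peaks_def peaks_def)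

lemma abs_peak_poly_mono:
  assumes "admissible S" "0 < j" "j < k" "poly (peak_poly S) (real k) \<noteq> 0"
  shows "\<bar>poly (peak_poly S) (real j)\<bar> \<le> \<bar>poly (peak_poly S) (real k)\<bar> \<or>
    ({2} \<subset> S \<and> j = 1 \<and> k = 3 \<and>
      poly (peak_poly S) 1 = - 2 * poly (peak_poly S) 3 \<and>
      - 2 * poly (peak_poly S) 3 = - ((- 2) ^ (card S - 1)))"
proof -
  \<comment> \<open>Above \<open>j\<close> lie \<open>D\<close> and \<open>W\<close>, above
    \<open>k\<close> only \<open>W\<close>; the peaks in \<open>D\<close> are the ones that cost
    factors of 2.\<close>
  define T D U W where "T = S \<inter> {..j}" and "D = S \<inter> {j<..k}" and "U = S \<inter> {..k}" and "W = S \<inter> {k<..}"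
  have fin: "finite S" "finite D" "finite W"
    using assms(1) by (auto simp: admissible_def D_def W_def)
  have S: "S = T \<union> (D \<union> W)" "S = U \<union> W" "U = T \<union> D"
    using assms(3) by (auto simp: T_def D_def U_def W_def)
  have sub: "T \<subseteq> {..j}" "D \<union> W \<subseteq> {j<..}" "U \<subseteq> {..k}" "W \<subseteq> {k<..}" "W \<subseteq> {j<..}"
    using assms(3) by (auto simp: T_def D_def U_def W_def)
  have cardDW: "card (D \<union> W) = card D + card W"
    using fin by (intro card_Un_disjoint) (auto simp: D_def W_def)
  have k: "0 < k"
    using assms by simp
  define pT pU where "pT = poly (peak_poly T) (real j)" and "pU = poly (peak_poly U) (real k)"
  have nonneg: "0 \<le> pT" "0 \<le> pU"
    using poly_peak_poly_nonneg sub assms(2) k by (auto simp: pT_def pU_def)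
  \<comment> \<open>The factor contributed by \<open>W\<close>; if \<open>D\<close> is empty it is
    common to both arguments.\<close>
  obtain ck where ck: "poly (peak_poly S) (real k) = ck * pU"
    "W = {} \<Longrightarrow> ck = 1" "W \<noteq> {} \<Longrightarrow> ck \<in> {0, (- 1) ^ card W * 2 ^ (card W - 1)}"
    "D = {} \<Longrightarrow> poly (peak_poly S) (real j) = ck * pT"
  proof (cases "W = {}")
    case True
    then show ?thesis
      using S by (intro that[of 1]) (auto simp: pU_def pT_def)
  next
    case False
    then obtain c where c: "c \<in> {0, (- 1) ^ card W * 2 ^ (card W - 1)}"
      "\<And>T j. 0 < j \<Longrightarrow> T \<subseteq> {..j} \<Longrightarrow> W \<subseteq> {j<..} \<Longrightarrow>
        poly (peak_poly (T \<union> W)) (real j) = c * poly (peak_poly T) (real j)"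
      using poly_peak_poly_below[OF fin(3)] by blast
    show ?thesis
      using c(2)[OF k sub(3,4)] c(2)[OF assms(2) sub(1,5)] c(1) S False
      by (intro that[of c]) (auto simp: pU_def pT_def)
  qed
  have ne: "ck \<noteq> 0" "pU \<noteq> 0"
    using assms(4) ck(1) by auto
  show ?thesis
  proof (cases "D = {}")
    case True
    then have "pT \<le> pU"
      unfolding pT_def pU_def using S(3) poly_peak_poly_mono[OF assms(2) sub(1)] assms(3) by simp
    then show ?thesis
      using ck(1) ck(4)[OF True] nonneg by (simp add: abs_mult mult_left_mono)
  next
    case False
    then obtain cj where cj: "cj \<in> {0, (- 1) ^ card (D \<union> W) * 2 ^ (card (D \<union> W) - 1)}"
      "poly (peak_poly S) (real j) = cj * pT"
      using poly_peak_poly_below[of "D \<union> W"] fin assms(2) sub(1,2) S(1) unfolding pT_def by blast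
    have cardD: "0 < card D"
      using False fin by (simp add: card_gt_0_iff)
    have "\<bar>cj\<bar> \<le> 2 ^ (card D + card W - 1)"
      using cj(1) by (auto simp: abs_mult power_abs cardDW)
    then have le_j: "\<bar>poly (peak_poly S) (real j)\<bar> \<le> 2 ^ (card D + card W - 1) * pT"
      using cj(2) nonneg by (simp add: abs_mult mult_right_mono)
    \<comment> \<open>For empty \<open>W\<close> the exponent truncates to 0, in agreement with
      \<open>ck = 1\<close>.\<close>
    have eq_k: "\<bar>poly (peak_poly S) (real k)\<bar> = 2 ^ (card W - 1) * pU"
    proof (cases "W = {}")
      case False
      then show ?thesis
        using ck(1,3) ne nonneg by (auto simp: abs_mult power_abs)
    qed (use ck nonneg in auto)
    have kS: "k \<notin> U"
      using ne(2) poly_peak_poly_Max[OF k sub(3)] by (auto simp: pU_def)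
    \<comment> \<open>Comparing the two powers of 2 leaves a factor of at most
      \<open>2 ^ card D\<close> to be compensated.\<close>
    have *: ?thesis if "2 ^ card D * pT \<le> pU"
    proof -
      have "(2::real) ^ (card D + card W - 1) \<le> 2 ^ (card W - 1) * 2 ^ card D"
        unfolding power_add[symmetric] using cardD by (intro power_increasing) auto
      then have "2 ^ (card D + card W - 1) * pT \<le> 2 ^ (card W - 1) * (2 ^ card D * pT)"
        using nonneg by (simp add: mult_right_mono flip: mult.assoc)
      also have "\<dots> \<le> 2 ^ (card W - 1) * pU"
        using that by (intro mult_left_mono) auto
      finally show ?thesis
        using le_j eq_k by linarith
    qed
    have nc: "\<forall>i\<in>U. Suc i \<notin> U" "\<forall>i\<in>U. 2 \<le> i"
      using admissible_peaks[OF assms(1)] by (auto simp: U_def)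
    show ?thesis
    proof (cases "2 \<in> D")
      case False
      have "\<forall>i\<in>D. 3 \<le> i"
        using False nc(2) S(3) by (metis UnCI nat_less_le numeral_3_eq_3 numeral_2_eq_2 Suc_leI)
      moreover have "D \<subseteq> {j<..<k}"
        using kS S(3) by (auto simp: D_def nat_less_le)
      ultimately have "2 ^ card D * pT \<le> pU"
        unfolding pT_def pU_def S(3)
        using fin assms(2,3) sub(1) nc(1) S(3) by (intro poly_peak_poly_Un_ge) auto
      then show ?thesis
        by (rule *)
    next
      case True
      then have j: "j = 1"
        using assms(2) by (auto simp: D_def)
      then have T: "T = {}"
        using admissible_peaks(1)[OF assms(1)] by (fastforce simp: T_def)
      then have pT: "pT = 1"
        by (simp add: pT_def peak_poly_empty)
      have k3: "3 \<le> k"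
        \<comment> \<open>If \<open>k = 2\<close>, then \<open>k\<close> would be a peak and the
          value at \<open>k\<close> would vanish.\<close>
        using True kS S(3) by (cases "k = 2") (auto simp: D_def)
      show ?thesis
      proof (cases "k = 3")
        case False
        define V where "V = D - {2}"
        have D: "D = insert 2 V" "2 \<notin> V" "finite V"
          using True fin by (auto simp: V_def)
        have V: "4 \<le> i" "i < k" if "i \<in> V" for i
        proof -
          have "i \<in> U" "i \<noteq> 2" "2 \<in> U"
            using that D S(3) by auto
          moreover from this have "2 \<le> i" "i \<le> k" "i \<noteq> k" "Suc 2 \<notin> U"
            using nc sub(3) kS by blast+
          moreover from this have "i \<noteq> 3"
            using \<open>i \<in> U\<close> by (intro notI) simp
          ultimately show "4 \<le> i" "i < k"
            by linarith+
        qed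
        have "2 ^ Suc (card V) \<le> poly (peak_poly (insert 2 V)) (real k)"
          using D V k3 False nc(1) S(3) by (intro poly_peak_poly_insert_2_ge) auto
        then show ?thesis
          using D pT S(3) T by (intro *) (simp add: pU_def)
      next
        case True
        have "x = 2" if "x \<in> U" for x
        proof -
          have "x \<le> 3" "x \<noteq> 3" "2 \<le> x"
            using that True kS sub(3) nc(2) by auto
          then show ?thesis
            by linarith
        qed
        moreover have "U = D"
          using S(3) T by simp
        ultimately have U: "D = {2}" "U = {2}"
          using \<open>2 \<in> D\<close> by blast+
        then have pU: "pU = 1"
          using True poly_peak_poly_2[of 3] by (simp add: pU_def)
        show ?thesis
        \<comment> \<open>Now \<open>pT = pU = 1\<close>. If \<open>W\<close> is empty, both bounds
          are 1; otherwise a nonzero \<open>cj\<close> is \<open>- 2 * ck\<close>, which is the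
          exception.\<close>
        proof (cases "W = {} \<or> cj = 0")
          case True
          then show ?thesis
            using le_j eq_k U pT pU cj(2) by auto
        next
          case False
          then have W: "0 < card W"
            using fin by (simp add: card_gt_0_iff)
          have card: "card S = Suc (card W)"
            using cardDW U S(1) T by simp
          have "poly (peak_poly S) 3 = (- 1) ^ card W * 2 ^ (card W - 1)"
            using ck(1,3) ne False pU True by auto
          moreover have "poly (peak_poly S) 1 = (- 1) ^ Suc (card W) * 2 ^ card W"
            using cj False pT j U cardDW by auto
          moreover have "(- 2::real) ^ card W = (- 1) ^ card W * 2 ^ card W"
            by (simp flip: power_mult_distrib)
          moreover have "{2} \<subset> S"
            using S(2) U False sub(4) True by auto
          ultimately show ?thesis
            using card W j True by (cases "card W") auto
        qed
      qed
    qed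
  qed
qed

theorem theorem4p5:
  fixes S :: "nat set" and j k :: int
  assumes "admissible S" and "S \<noteq> {}"
    and "1 \<le> j" and "j < k"
    and "poly (peak_poly S) (of_int k) \<noteq> 0"
  shows "\<bar>poly (peak_poly S) (of_int j)\<bar> \<le> \<bar>poly (peak_poly S) (of_int k)\<bar> \<or>
    ({2} \<subset> S \<and> j = 1 \<and> k = 3 \<and>
      poly (peak_poly S) 1 = - 2 * poly (peak_poly S) 3 \<and>
      - 2 * poly (peak_poly S) 3 = - ((- 2) ^ (card S - 1)))"
proof -
  obtain j' where j: "j = int j'"
    using assms(3) nonneg_int_cases[of j] by auto
  obtain k' where k: "k = int k'"
    using assms(3,4) nonneg_int_cases[of k] by auto
  show ?thesis
    using abs_peak_poly_mono[OF assms(1), of j' k'] assms(3-5) by (simp add: j k)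
qed

end
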